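(* Let $n\ge 1$. If $T\subseteq[n]$, then $|LS^n_T| = |LC^n_T|$. In other words, the number of frustrated parking functions of length $n$ whose set of lucky spots is $T$ equals the number of frustrated parking functions of length $n$ whose set of positions of lucky cars is $T$.
   Context: Let $n\ge 1$ and $[n]=\{1,2,\dots,n\}$. There are $n$ cars and $n$ parking spots numbered $1,\dots,n$, all initially empty. Given a preference sequence $(a_1,\dots,a_n)\in[n]^n$, cars $1,2,\dots,n$ enter in this order. If spot $a_i$ is unoccupied when car $i$ enters, car $i$ parks in spot $a_i$. Otherwise car $i$ parks in the largest-numbered unoccupied spot greater than $a_i$, if such a spot exists; if none exists, car $i$ cannot park. The sequence $(a_1,\dots,a_n)$ is a frustrated parking function of length $n$ if all $n$ cars can park under this rule. For a frustrated parking function, car $j$ is lucky if it parks in its preferred spot $a_j$, and unlucky otherwise; a spot is lucky if the car that parks in it is lucky, and unlucky otherwise. For $T\subseteq[n]$, $LS^n_T$ is the set of frustrated parking functions of length $n$ whose set of lucky spots is exactly $T$, and $LC^n_T$ is the set of frustrated parking functions of length $n$ whose set of positions (indices $j$) of lucky cars is exactly $T$. *)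

theory Defs
  imports Main
begin

definition parking_spot :: "nat \<Rightarrow> nat set \<Rightarrow> nat \<Rightarrow> nat option" where
  "parking_spot n occ a =
    (let free = {s \<in> {1..n}. s \<notin> occ \<and> a < s} in
      if a \<notin> occ then Some a
      else if free \<noteq> {} then Some (Max free)
      else None)"

(* A car that cannot park (None) leaves without occupying a spot. *)
primrec park_from :: "nat \<Rightarrow> nat set \<Rightarrow> nat list \<Rightarrow> nat option list" where
  "park_from n occ [] = []"
| "park_from n occ (a # as) =
    (let p = parking_spot n occ a in p # park_from n (occ \<union> set_option p) as)"

(* Cars are numbered from 1, list positions from 0: car j prefers as ! (j - 1), and the
   entry at position j - 1 of the outcome records where it parks. *)
definition parking_outcome :: "nat \<Rightarrow> nat list \<Rightarrow> nat option list" where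
  "parking_outcome n as = park_from n {} as"

definition frustrated_parking_function :: "nat \<Rightarrow> nat list \<Rightarrow> bool" where
  "frustrated_parking_function n as \<longleftrightarrow>
    length as = n \<and> set as \<subseteq> {1..n} \<and> None \<notin> set (parking_outcome n as)"

definition lucky_cars :: "nat \<Rightarrow> nat list \<Rightarrow> nat set" where
  "lucky_cars n as =
    {j \<in> {1..n}. parking_outcome n as ! (j - 1) = Some (as ! (j - 1))}"

definition lucky_spots :: "nat \<Rightarrow> nat list \<Rightarrow> nat set" where
  "lucky_spots n as =
    {s \<in> {1..n}. \<exists>j \<in> lucky_cars n as. parking_outcome n as ! (j - 1) = Some s}"

definition LS :: "nat \<Rightarrow> nat set \<Rightarrow> nat list set" where
  "LS n T = {as. frustrated_parking_function n as \<and> lucky_spots n as = T}"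

definition LC :: "nat \<Rightarrow> nat set \<Rightarrow> nat list set" where
  "LC n T = {as. frustrated_parking_function n as \<and> lucky_cars n as = T}"

lemma finite_frustrated_parking_functions:
  "finite {as. frustrated_parking_function n as}"
  by (rule finite_subset[OF _ finite_lists_length_eq[of "{1..n}" n]])
     (auto simp: frustrated_parking_function_def)

lemma finite_LS: "finite (LS n T)" and finite_LC: "finite (LC n T)"
  unfolding LS_def LC_def
  by (auto intro: finite_subset[OF _ finite_frustrated_parking_functions[of n]])

end

theory Submission
  imports Defs
begin

text \<open>
  The count is symmetric because the whole situation is invariant under exchanging time and space.
  Plot car \<open>j\<close> parked in spot \<open>\<sigma> j\<close> as the point \<open>(j, \<sigma> j)\<close>.  An unlucky car takes the largest free
  spot above its preference, and this is the largest free spot altogether, since every larger spot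
  also lies above the preference.  Hence no point lies to the north-east of an unlucky point, and
  the preference of the unlucky car can be the spot of any point to the south-west: a lower spot
  taken earlier.  Conversely, a permutation together with a choice, for each car, of its own point
  or of a south-west point, the latter only if the north-east quadrant is empty, comes from exactly
  one frustrated parking function.

  These conditions are preserved by reflection in the diagonal, which replaces \<open>\<sigma>\<close> by its inverse
  \<open>\<tau>\<close> and the preference function \<open>a\<close> by \<open>\<tau> \<circ> a \<circ> \<tau>\<close>.  The reflection is an involution on
  frustrated parking functions that turns lucky spots into lucky cars and vice versa.  The lemmas
  \<open>frustrated_imp_arrangement\<close> and \<open>arrangement_imp_frustrated\<close> establish the description by points,
  and \<open>arrangement_reflect\<close> is its symmetry.
\<close>

section \<open>Parking as a local condition on a permutation\<close>

lemma length_park_from [simp]: "length (park_from n occ as) = length as"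
  by (induction as arbitrary: occ) (simp_all add: Let_def)

lemma park_from_nth:
  assumes "i < length as"
  shows "park_from n occ as ! i =
    parking_spot n (occ \<union> (\<Union>k<i. set_option (park_from n occ as ! k))) (as ! i)"
  using assms
proof (induction as arbitrary: occ i)
  case Nil
  then show ?case by simp
next
  case (Cons a as)
  show ?case
  proof (cases i)
    case 0
    then show ?thesis by (simp add: Let_def)
  next
    case (Suc m)
    have "(\<Union>k<Suc m. set_option (park_from n occ (a # as) ! k)) =
      set_option (parking_spot n occ a) \<union>
      (\<Union>k<m. set_option (park_from n (occ \<union> set_option (parking_spot n occ a)) as ! k))"
      by (subst lessThan_Suc_eq_insert_0) (simp add: Let_def)
    with Suc Cons show ?thesis by (simp add: Let_def Un_assoc)
  qed
qed

lemma parking_outcome_nth: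
  assumes "j \<in> {1..length as}"
  shows "parking_outcome n as ! (j - 1) =
    parking_spot n (\<Union>i\<in>{1..<j}. set_option (parking_outcome n as ! (i - 1))) (as ! (j - 1))"
proof -
  have "{1..<j} = Suc ` {..<j - 1}"
    using assms by (auto simp: image_Suc_lessThan)
  moreover have "j - 1 < length as"
    using assms by auto
  ultimately show ?thesis
    using park_from_nth[of "j - 1" as n "{}"] by (simp add: parking_outcome_def)
qed

text \<open>
  In the picture of points \<open>(j, \<sigma> j)\<close>, the index \<open>i\<close> names the south-west point whose spot an
  unlucky car \<open>j\<close> prefers.  Referring to that point instead of to the spot itself makes the
  condition visibly symmetric in the two coordinates.
\<close>
definition arrangement :: "nat \<Rightarrow> (nat \<Rightarrow> nat) \<Rightarrow> (nat \<Rightarrow> nat) \<Rightarrow> bool" where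
  "arrangement n a \<sigma> \<longleftrightarrow> bij_betw \<sigma> {1..n} {1..n} \<and>
    (\<forall>j\<in>{1..n}. a j = \<sigma> j \<or>
      (\<exists>i\<in>{1..n}. a j = \<sigma> i \<and> i < j \<and> \<sigma> i < \<sigma> j \<and> (\<forall>k\<in>{1..n}. j < k \<longrightarrow> \<sigma> k < \<sigma> j)))"

text \<open>
  The last disjunct compares \<open>s\<close> with all free spots, not only with those above \<open>a\<close>: a free spot
  larger than \<open>s\<close> would also lie above \<open>a\<close> and would have been chosen instead.
\<close>
lemma parking_spot_SomeD:
  assumes "parking_spot n occ a = Some s" and "a \<in> {1..n}"
  shows "s \<in> {1..n}" and "s \<notin> occ"
    and "s = a \<or> a \<in> occ \<and> a < s \<and> (\<forall>r\<in>{1..n}. r \<notin> occ \<longrightarrow> r \<le> s)"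
proof -
  define free where "free = {s \<in> {1..n}. s \<notin> occ \<and> a < s}"
  have fin: "finite free" by (simp add: free_def)
  consider "a \<notin> occ" "s = a" | "a \<in> occ" "free \<noteq> {}" "s = Max free"
    using assms(1) unfolding parking_spot_def Let_def free_def[symmetric]
    by (auto split: if_splits)
  then have "s \<in> {1..n} \<and> s \<notin> occ \<and>
    (s = a \<or> a \<in> occ \<and> a < s \<and> (\<forall>r\<in>{1..n}. r \<notin> occ \<longrightarrow> r \<le> s))"
  proof cases
    case 1
    then show ?thesis using assms(2) by simp
  next
    case 2
    with fin have s: "s \<in> free" by simp
    have "r \<le> s" if "r \<in> {1..n}" "r \<notin> occ" for r
    proof (cases "a < r")
      case True
      with that have "r \<in> free" by (simp add: free_def)
      with fin 2 show ?thesis by simp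
    next
      case False
      with s show ?thesis by (simp add: free_def)
    qed
    with 2 s show ?thesis by (simp add: free_def)
  qed
  then show "s \<in> {1..n}" and "s \<notin> occ"
    and "s = a \<or> a \<in> occ \<and> a < s \<and> (\<forall>r\<in>{1..n}. r \<notin> occ \<longrightarrow> r \<le> s)"
    by blast+
qed

lemma frustrated_imp_arrangement:
  assumes "frustrated_parking_function n as"
  shows "arrangement n (\<lambda>j. as ! (j - 1)) (\<lambda>j. the (parking_outcome n as ! (j - 1)))"
proof -
  define a where "a = (\<lambda>j. as ! (j - 1))"
  define \<sigma> where "\<sigma> = (\<lambda>j. the (parking_outcome n as ! (j - 1)))"
  have len: "length as = n" and sub: "set as \<subseteq> {1..n}"
    and parked: "None \<notin> set (parking_outcome n as)"
    using assms by (auto simp: frustrated_parking_function_def)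
  have out: "parking_outcome n as ! (j - 1) = Some (\<sigma> j)" if "j \<in> {1..n}" for j
  proof -
    have "parking_outcome n as ! (j - 1) \<in> set (parking_outcome n as)"
      using that len by (intro nth_mem) (auto simp: parking_outcome_def)
    with parked show ?thesis by (cases "parking_outcome n as ! (j - 1)") (auto simp: \<sigma>_def)
  qed
  have spot: "parking_spot n (\<sigma> ` {1..<j}) (a j) = Some (\<sigma> j)" if "j \<in> {1..n}" for j
  proof -
    have "(\<Union>i\<in>{1..<j}. set_option (parking_outcome n as ! (i - 1))) = (\<Union>i\<in>{1..<j}. {\<sigma> i})"
      by (rule SUP_cong) (use that in \<open>auto simp: out[unfolded One_nat_def]\<close>)
    also have "\<dots> = \<sigma> ` {1..<j}" by blast
    finally show ?thesis
      using parking_outcome_nth[of j as n] out[OF that] that len by (simp add: a_def)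
  qed
  have a: "a j \<in> {1..n}" if "j \<in> {1..n}" for j
  proof -
    have "j - 1 < length as" using that len by auto
    then show ?thesis unfolding a_def using sub nth_mem by blast
  qed
  note D = parking_spot_SomeD[OF spot a]
  have neq: "\<sigma> i \<noteq> \<sigma> j" if "i \<in> {1..n}" "j \<in> {1..n}" "i < j" for i j
  proof -
    have "\<sigma> i \<in> \<sigma> ` {1..<j}" using that by simp
    with D(2)[OF that(2) that(2)] show ?thesis by metis
  qed
  have inj: "inj_on \<sigma> {1..n}"
    by (rule linorder_inj_onI') (use neq in blast)
  have "\<sigma> ` {1..n} = {1..n}"
    by (rule endo_inj_surj) (use D(1) inj in auto)
  with inj have bij: "bij_betw \<sigma> {1..n} {1..n}" by (simp add: bij_betw_def)
  have "\<exists>i\<in>{1..n}. a j = \<sigma> i \<and> i < j \<and> \<sigma> i < \<sigma> j \<and> (\<forall>k\<in>{1..n}. j < k \<longrightarrow> \<sigma> k < \<sigma> j)"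
    if j: "j \<in> {1..n}" and unlucky: "a j \<noteq> \<sigma> j" for j
  proof -
    have *: "a j \<in> \<sigma> ` {1..<j}" "a j < \<sigma> j"
      "\<forall>r\<in>{1..n}. r \<notin> \<sigma> ` {1..<j} \<longrightarrow> r \<le> \<sigma> j"
      using D(3)[OF j j] unlucky by auto
    then obtain i where i: "i \<in> {1..<j}" "a j = \<sigma> i" by blast
    have "\<sigma> k < \<sigma> j" if k: "k \<in> {1..n}" "j < k" for k
    proof -
      have "\<sigma> k \<notin> \<sigma> ` {1..<j}"
        using neq[of _ k] k by force
      with *(3) D(1)[OF k(1) k(1)] have "\<sigma> k \<le> \<sigma> j" by blast
      with neq[OF j k] show ?thesis by simp
    qed
    with i *(2) j show ?thesis by (intro bexI[of _ i]) auto
  qed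
  with bij have "arrangement n a \<sigma>" unfolding arrangement_def by blast
  then show ?thesis by (simp add: a_def \<sigma>_def)
qed

text \<open>
  The cars are forced, one after the other, into the spots of any arrangement that fits their
  preferences: if car \<open>j\<close> is unlucky, then \<open>\<sigma> j\<close> is free and every other free spot is \<open>\<sigma> k\<close> for
  some later car \<open>k\<close>, hence lower.  In particular the preferences determine \<open>\<sigma>\<close>.
\<close>
lemma arrangement_imp_frustrated:
  assumes "length as = n" and "arrangement n (\<lambda>j. as ! (j - 1)) \<sigma>"
  shows "frustrated_parking_function n as"
    and "\<And>j. j \<in> {1..n} \<Longrightarrow> parking_outcome n as ! (j - 1) = Some (\<sigma> j)"
proof -
  define a where "a = (\<lambda>j. as ! (j - 1))"
  have pref: "a j = \<sigma> j \<or> (\<exists>i\<in>{1..n}. a j = \<sigma> i \<and> i < j \<and> \<sigma> i < \<sigma> j \<and>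
      (\<forall>k\<in>{1..n}. j < k \<longrightarrow> \<sigma> k < \<sigma> j))" if "j \<in> {1..n}" for j
    using assms(2) that by (auto simp: arrangement_def a_def)
  have bij: "bij_betw \<sigma> {1..n} {1..n}"
    using assms(2) by (simp add: arrangement_def)
  then have inj: "inj_on \<sigma> {1..n}" and im: "\<sigma> ` {1..n} = {1..n}"
    by (auto simp: bij_betw_def)
  show out: "parking_outcome n as ! (j - 1) = Some (\<sigma> j)" if "j \<in> {1..n}" for j
    using that
  proof (induction j rule: less_induct)
    case (less j)
    have "(\<Union>i\<in>{1..<j}. set_option (parking_outcome n as ! (i - 1))) = (\<Union>i\<in>{1..<j}. {\<sigma> i})"
      by (rule SUP_cong) (use less in \<open>auto simp: less.IH[unfolded One_nat_def]\<close>)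
    also have "\<dots> = \<sigma> ` {1..<j}" by blast
    finally have step:
      "parking_outcome n as ! (j - 1) = parking_spot n (\<sigma> ` {1..<j}) (a j)"
      using parking_outcome_nth[of j as n] less.prems assms(1) by (simp add: a_def)
    have free: "\<sigma> j \<notin> \<sigma> ` {1..<j}"
    proof
      assume "\<sigma> j \<in> \<sigma> ` {1..<j}"
      then obtain i where "i \<in> {1..<j}" "\<sigma> j = \<sigma> i" by blast
      with less.prems inj_onD[OF inj, of j i] show False by auto
    qed
    show ?case
    proof (cases "a j = \<sigma> j")
      case True
      with step free show ?thesis by (simp add: parking_spot_def)
    next
      case False
      with pref[OF less.prems] obtain i where
        i: "i \<in> {1..n}" "a j = \<sigma> i" "i < j" "\<sigma> i < \<sigma> j"
        and top: "\<And>k. k \<in> {1..n} \<Longrightarrow> j < k \<Longrightarrow> \<sigma> k < \<sigma> j" by blast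
      let ?free = "{s \<in> {1..n}. s \<notin> \<sigma> ` {1..<j} \<and> a j < s}"
      have mem: "\<sigma> j \<in> ?free"
        using im less.prems free i by auto
      have "s \<le> \<sigma> j" if "s \<in> ?free" for s
      proof -
        from that im obtain k where k: "k \<in> {1..n}" "s = \<sigma> k" by blast
        with that have "\<not> k < j" by auto
        with k top[of k] show ?thesis by (cases "k = j") auto
      qed
      then have "Max ?free = \<sigma> j" by (intro Max_eqI mem) auto
      moreover have "a j \<in> \<sigma> ` {1..<j}" using i by auto
      ultimately show ?thesis
        using step mem by (auto simp: parking_spot_def Let_def)
    qed
  qed
  have "s \<in> {1..n}" if "s \<in> set as" for s
  proof -
    from that assms(1) obtain m where m: "m < n" "s = as ! m" by (auto simp: in_set_conv_nth)
    then have "s = a (Suc m)" and "Suc m \<in> {1..n}" by (auto simp: a_def)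
    with pref[of "Suc m"] im show ?thesis by blast
  qed
  moreover have "None \<notin> set (parking_outcome n as)"
  proof
    assume "None \<in> set (parking_outcome n as)"
    then obtain m where "m < n" "parking_outcome n as ! m = None"
      using assms(1) by (auto simp: in_set_conv_nth parking_outcome_def)
    with out[of "Suc m"] show False by simp
  qed
  ultimately show "frustrated_parking_function n as"
    using assms(1) by (auto simp: frustrated_parking_function_def)
qed

section \<open>Reflection in the diagonal\<close>

text \<open>
  If \<open>j\<close> is the time at which spot \<open>s\<close> is filled, then the empty north-east quadrant of \<open>(j, s)\<close>
  and the south-west position of \<open>(i, \<sigma> i)\<close> read the same after exchanging the coordinates.
\<close>
lemma arrangement_reflect:
  assumes "arrangement n a \<sigma>"
  defines "\<tau> \<equiv> inv_into {1..n} \<sigma>"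
  shows "arrangement n (\<lambda>s. \<tau> (a (\<tau> s))) \<tau>"
proof -
  have bij: "bij_betw \<sigma> {1..n} {1..n}"
    using assms(1) by (simp add: arrangement_def)
  then have bij': "bij_betw \<tau> {1..n} {1..n}"
    unfolding \<tau>_def by (rule bij_betw_inv_into)
  have \<tau>\<sigma>: "\<tau> (\<sigma> j) = j" if "j \<in> {1..n}" for j
    unfolding \<tau>_def by (rule bij_betw_inv_into_left[OF bij that])
  have \<sigma>\<tau>: "\<sigma> (\<tau> s) = s" if "s \<in> {1..n}" for s
    unfolding \<tau>_def by (rule bij_betw_inv_into_right[OF bij that])
  have \<sigma>: "\<sigma> j \<in> {1..n}" if "j \<in> {1..n}" for j by (rule bij_betw_apply[OF bij that])
  have \<tau>: "\<tau> s \<in> {1..n}" if "s \<in> {1..n}" for s by (rule bij_betw_apply[OF bij' that])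
  have "\<exists>r\<in>{1..n}. \<tau> (a (\<tau> s)) = \<tau> r \<and> r < s \<and> \<tau> r < \<tau> s \<and>
      (\<forall>q\<in>{1..n}. s < q \<longrightarrow> \<tau> q < \<tau> s)"
    if s: "s \<in> {1..n}" and unlucky: "\<tau> (a (\<tau> s)) \<noteq> \<tau> s" for s
  proof -
    from unlucky \<sigma>\<tau>[OF s] have "a (\<tau> s) \<noteq> \<sigma> (\<tau> s)" by metis
    with assms(1) \<tau>[OF s] obtain i where
      i: "i \<in> {1..n}" "a (\<tau> s) = \<sigma> i" "i < \<tau> s" "\<sigma> i < \<sigma> (\<tau> s)"
      and top: "\<And>k. k \<in> {1..n} \<Longrightarrow> \<tau> s < k \<Longrightarrow> \<sigma> k < \<sigma> (\<tau> s)"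
      unfolding arrangement_def by blast
    have "\<tau> q < \<tau> s" if q: "q \<in> {1..n}" "s < q" for q
    proof (rule ccontr)
      assume "\<not> \<tau> q < \<tau> s"
      moreover have "\<tau> q \<noteq> \<tau> s" using \<sigma>\<tau>[OF q(1)] \<sigma>\<tau>[OF s] q(2) by auto
      ultimately have "\<sigma> (\<tau> q) < \<sigma> (\<tau> s)" using top[OF \<tau>[OF q(1)]] by simp
      with \<sigma>\<tau>[OF q(1)] \<sigma>\<tau>[OF s] q(2) show False by simp
    qed
    with i \<sigma>[OF i(1)] \<tau>\<sigma>[OF i(1)] \<sigma>\<tau>[OF s] show ?thesis
      by (intro bexI[of _ "\<sigma> i"]) auto
  qed
  with bij' show ?thesis unfolding arrangement_def by blast
qed

definition reflect :: "nat \<Rightarrow> nat list \<Rightarrow> nat list" where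
  "reflect n as =
    (let \<tau> = inv_into {1..n} (\<lambda>j. the (parking_outcome n as ! (j - 1)))
     in map (\<lambda>s. \<tau> (as ! (\<tau> s - 1))) [1..<Suc n])"

lemma arrangement_cong:
  assumes "\<And>j. j \<in> {1..n} \<Longrightarrow> a j = b j"
  shows "arrangement n a \<sigma> \<longleftrightarrow> arrangement n b \<sigma>"
  unfolding arrangement_def using assms by simp

lemma reflect:
  assumes fpf: "frustrated_parking_function n as"
  shows "frustrated_parking_function n (reflect n as)"
    and "reflect n (reflect n as) = as"
    and "lucky_cars n (reflect n as) = lucky_spots n as"
    and "lucky_spots n (reflect n as) = lucky_cars n as"
proof -
  define a where "a = (\<lambda>j. as ! (j - 1))"
  define \<sigma> where "\<sigma> = (\<lambda>j. the (parking_outcome n as ! (j - 1)))"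
  define \<tau> where "\<tau> = inv_into {1..n} \<sigma>"
  define bs where "bs = reflect n as"
  have len: "length as = n" using fpf by (simp add: frustrated_parking_function_def)
  have arr: "arrangement n a \<sigma>"
    using frustrated_imp_arrangement[OF fpf] by (simp add: a_def \<sigma>_def)
  then have bij: "bij_betw \<sigma> {1..n} {1..n}" by (simp add: arrangement_def)
  have \<tau>\<sigma>: "\<tau> (\<sigma> j) = j" if "j \<in> {1..n}" for j
    unfolding \<tau>_def by (rule bij_betw_inv_into_left[OF bij that])
  have \<sigma>\<tau>: "\<sigma> (\<tau> s) = s" if "s \<in> {1..n}" for s
    unfolding \<tau>_def by (rule bij_betw_inv_into_right[OF bij that])
  have \<sigma>: "\<sigma> j \<in> {1..n}" if "j \<in> {1..n}" for j by (rule bij_betw_apply[OF bij that])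
  have \<tau>: "\<tau> s \<in> {1..n}" if "s \<in> {1..n}" for s
    unfolding \<tau>_def by (rule bij_betw_apply[OF bij_betw_inv_into[OF bij] that])
  have a: "a j \<in> {1..n}" if "j \<in> {1..n}" for j
    using arr \<sigma> that unfolding arrangement_def by fastforce
  have out: "parking_outcome n as ! (j - 1) = Some (\<sigma> j)" if "j \<in> {1..n}" for j
    using arrangement_imp_frustrated(2)[of as n \<sigma> j] len arr that by (simp add: a_def)

  have bs_eq: "bs = map (\<lambda>s. \<tau> (a (\<tau> s))) [1..<Suc n]"
    by (simp only: bs_def reflect_def Let_def a_def \<tau>_def \<sigma>_def)
  have len': "length bs = n" by (simp add: bs_eq)
  have b: "bs ! (s - 1) = \<tau> (a (\<tau> s))" if "s \<in> {1..n}" for s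
    using that by (auto simp: bs_eq simp del: upt_Suc)
  have "arrangement n (\<lambda>s. bs ! (s - 1)) \<tau>"
    using arrangement_reflect[OF arr] b by (subst arrangement_cong[OF b]) (simp_all add: \<tau>_def)
  note B = arrangement_imp_frustrated[OF len' this]
  show "frustrated_parking_function n (reflect n as)"
    using B(1) by (simp add: bs_def)

  have lucky_as: "lucky_cars n as = {j \<in> {1..n}. \<sigma> j = a j}"
    using out by (auto simp: lucky_cars_def a_def)
  have lucky_bs: "lucky_cars n bs = {s \<in> {1..n}. \<tau> s = \<tau> (a (\<tau> s))}"
    using B(2) b by (auto simp: lucky_cars_def)
  \<comment> \<open>Car \<open>s\<close> is lucky after the reflection iff the car parked in spot \<open>s\<close> was lucky before.\<close>
  have lucky_iff: "\<tau> s = \<tau> (a (\<tau> s)) \<longleftrightarrow> \<sigma> (\<tau> s) = a (\<tau> s)" if "s \<in> {1..n}" for s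
    using \<sigma>\<tau>[OF that] \<sigma>\<tau>[OF a[OF \<tau>[OF that]]] by metis
  have spots_as: "lucky_spots n as = \<sigma> ` lucky_cars n as"
  proof -
    have "lucky_spots n as = {s \<in> {1..n}. \<exists>j\<in>lucky_cars n as. \<sigma> j = s}"
      unfolding lucky_spots_def
      by (intro Collect_cong conj_cong bex_cong refl) (use out lucky_as in auto)
    moreover have "\<sigma> j \<in> {1..n}" if "j \<in> lucky_cars n as" for j
      using \<sigma>[of j] that unfolding lucky_as by blast
    ultimately show ?thesis by (auto simp del: atLeastAtMost_iff)
  qed
  have spots_bs: "lucky_spots n bs = \<tau> ` lucky_cars n bs"
  proof -
    have "lucky_spots n bs = {s \<in> {1..n}. \<exists>j\<in>lucky_cars n bs. \<tau> j = s}"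
      unfolding lucky_spots_def
      by (intro Collect_cong conj_cong bex_cong refl) (use B(2) lucky_bs in auto)
    moreover have "\<tau> j \<in> {1..n}" if "j \<in> lucky_cars n bs" for j
      using \<tau>[of j] that unfolding lucky_bs by blast
    ultimately show ?thesis by (auto simp del: atLeastAtMost_iff)
  qed
  have cars_bs: "lucky_cars n bs = \<sigma> ` lucky_cars n as"
  proof (intro equalityI subsetI)
    fix s assume "s \<in> lucky_cars n bs"
    then have "s \<in> {1..n}" "\<sigma> (\<tau> s) = a (\<tau> s)" using lucky_bs lucky_iff by auto
    with \<tau> \<sigma>\<tau> show "s \<in> \<sigma> ` lucky_cars n as"
      unfolding lucky_as by (intro image_eqI[of _ _ "\<tau> s"]) auto
  next
    fix s assume "s \<in> \<sigma> ` lucky_cars n as"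
    then obtain j where "j \<in> {1..n}" "\<sigma> j = a j" "s = \<sigma> j" by (auto simp: lucky_as)
    with \<sigma> \<tau>\<sigma> show "s \<in> lucky_cars n bs" unfolding lucky_bs by force
  qed
  show "lucky_cars n (reflect n as) = lucky_spots n as"
    using cars_bs spots_as by (simp add: bs_def)
  have "\<tau> ` \<sigma> ` lucky_cars n as = lucky_cars n as"
    using \<tau>\<sigma> lucky_as by (force simp: image_iff)
  then show "lucky_spots n (reflect n as) = lucky_cars n as"
    using spots_bs cars_bs by (simp add: bs_def)

  define \<rho> where "\<rho> = inv_into {1..n} (\<lambda>j. the (parking_outcome n bs ! (j - 1)))"
  \<comment> \<open>Off \<open>{1..n}\<close> the inverse of the inverse is arbitrary, so \<open>\<rho>\<close> agrees with \<open>\<sigma>\<close> only on \<open>{1..n}\<close>.\<close>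
  have \<rho>: "\<rho> j = \<sigma> j" if j: "j \<in> {1..n}" for j
    unfolding \<rho>_def
  proof (rule inv_into_f_eq)
    have "inj_on \<tau> {1..n}" by (rule inj_on_inverseI[of _ \<sigma>]) (rule \<sigma>\<tau>)
    moreover have "the (parking_outcome n bs ! (s - 1)) = \<tau> s" if "s \<in> {1..n}" for s
      using B(2)[OF that] by simp
    ultimately show "inj_on (\<lambda>j. the (parking_outcome n bs ! (j - 1))) {1..n}"
      by (subst inj_on_cong[where g = \<tau>])
    show "\<sigma> j \<in> {1..n}" by (rule \<sigma>[OF j])
    show "the (parking_outcome n bs ! (\<sigma> j - 1)) = j"
      using B(2)[OF \<sigma>[OF j]] \<tau>\<sigma>[OF j] by simp
  qed
  have rr: "reflect n bs = map (\<lambda>j. \<rho> (bs ! (\<rho> j - 1))) [1..<Suc n]"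
    by (simp only: reflect_def Let_def \<rho>_def)
  have "reflect n bs = as"
  proof (rule nth_equalityI)
    show "length (reflect n bs) = length as" by (simp add: rr len del: upt_Suc)
  next
    fix m assume "m < length (reflect n bs)"
    then have m: "m < n" by (simp add: rr del: upt_Suc)
    define j where "j = Suc m"
    have j: "j \<in> {1..n}" using m by (simp add: j_def)
    have "reflect n bs ! m = \<rho> (bs ! (\<rho> j - 1))"
      using m by (simp add: rr j_def del: upt_Suc)
    also have "\<dots> = \<rho> (\<tau> (a j))"
      using b[OF \<sigma>[OF j]] \<rho>[OF j] \<tau>\<sigma>[OF j] by simp
    also have "\<dots> = a j"
      using \<rho>[OF \<tau>[OF a[OF j]]] \<sigma>\<tau>[OF a[OF j]] by simp
    finally show "reflect n bs ! m = as ! m" by (simp add: a_def j_def)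
  qed
  then show "reflect n (reflect n as) = as" by (simp add: bs_def)
qed

theorem theorem2p22:
  fixes n :: nat and T :: "nat set"
  assumes "n \<ge> 1" and "T \<subseteq> {1..n}"
  shows "card (LS n T) = card (LC n T)"
proof -
  have "bij_betw (reflect n) (LS n T) (LC n T)"
    by (rule bij_betw_byWitness[where f' = "reflect n"]) (auto simp: LS_def LC_def reflect)
  then show ?thesis by (rule bij_betw_same_card)
qed

end
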